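(* Let $G$ be a planar graph on $n\ge 2$ vertices that admits an interval colouring. Then $t(G)\le \frac{3}{2}n-2$.
   Context: An interval colouring of a graph $G$ is a proper edge-colouring $c\colon E(G)\to\mathbb{N}$ such that for every vertex $v$, the set of colours on edges incident to $v$ is a set of consecutive integers. For an interval colourable graph $G$, $t(G)$ denotes the greatest number of distinct colours used in an interval colouring of $G$. *)

theory Defs
  imports "HOL-Analysis.Analysis"
begin

definition simple_graph :: "'a set \<Rightarrow> 'a set set \<Rightarrow> bool" where
  "simple_graph V E \<longleftrightarrow> finite V \<and> (\<forall>e\<in>E. e \<subseteq> V \<and> card e = 2)"

definition incident_edges :: "'a set set \<Rightarrow> 'a \<Rightarrow> 'a set set" where
  "incident_edges E v = {e \<in> E. v \<in> e}"

definition planar :: "'a set \<Rightarrow> 'a set set \<Rightarrow> bool" where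
  "planar V E \<longleftrightarrow>
     (\<exists>(p :: 'a \<Rightarrow> complex) (\<gamma> :: 'a set \<Rightarrow> real \<Rightarrow> complex).
        inj_on p V \<and>
        (\<forall>e\<in>E. arc (\<gamma> e) \<and> {pathstart (\<gamma> e), pathfinish (\<gamma> e)} = p ` e) \<and>
        (\<forall>e\<in>E. \<forall>v\<in>V. p v \<in> path_image (\<gamma> e) \<longrightarrow> v \<in> e) \<and>
        (\<forall>e\<in>E. \<forall>e'\<in>E. e \<noteq> e' \<longrightarrow>
            path_image (\<gamma> e) \<inter> path_image (\<gamma> e') \<subseteq> p ` (e \<inter> e')))"

definition interval_colouring :: "'a set \<Rightarrow> 'a set set \<Rightarrow> ('a set \<Rightarrow> nat) \<Rightarrow> bool" where
  "interval_colouring V E c \<longleftrightarrow>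
     (\<forall>e\<in>E. c e \<ge> 1) \<and>
     (\<forall>e\<in>E. \<forall>e'\<in>E. e \<noteq> e' \<and> e \<inter> e' \<noteq> {} \<longrightarrow> c e \<noteq> c e') \<and>
     (\<forall>v\<in>V. \<exists>a b. c ` incident_edges E v = {a..b})"

definition interval_colourable :: "'a set \<Rightarrow> 'a set set \<Rightarrow> bool" where
  "interval_colourable V E \<longleftrightarrow> (\<exists>c. interval_colouring V E c)"

definition t_max :: "'a set \<Rightarrow> 'a set set \<Rightarrow> nat" where
  "t_max V E = Max {card (c ` E) | c. interval_colouring V E c}"

end

theory Submission
  imports Defs
begin

text \<open>
  Induction on the number of edges. If every colour other than the smallest and the largest is used
  at least twice, then \<open>2t - 2 \<le> |E| \<le> 3n - 6\<close>. Otherwise some intermediate colour \<open>i\<close> occurs on a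
  single edge \<open>uv\<close>. Any vertex with both a colour \<open>\<le> i\<close> and a colour \<open>\<ge> i\<close> also sees \<open>i\<close>, so the
  edges of colour \<open>\<le> i\<close> and those of colour \<open>\<ge> i\<close> span two graphs that share only the vertices
  \<open>u\<close> and \<open>v\<close>; their orders add up to at most \<open>n + 2\<close>, their colour numbers to \<open>t + 1\<close>, and the two
  bounds \<open>3/2 n\<^sub>i - 2\<close> add up exactly to \<open>3/2 n - 2\<close>.

  The inequality \<open>|E| \<le> 3n - 6\<close> for topological drawings follows from \<open>|F| \<ge> |E| - n + 2\<close> (an edge
  joining two points of one component splits a face, by the Jordan curve theorem) and
  \<open>3|F| \<le> 2|E|\<close>. By Janiszewski's theorem every edge borders at most two faces, and two arcs with
  at most one common point do not separate the plane, so a face bordered by fewer than three edges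
  is the only one.
\<close>

section \<open>The edge bound for plane drawings\<close>

lemma connected_Compl_arc_image:
  fixes g :: "real \<Rightarrow> complex"
  assumes "arc g"
  shows "connected (- path_image g)"
proof -
  have "path_image g homeomorphic {0..1::real}"
    using homeomorphic_arc_image_interval[OF assms, of 0 1] by simp
  then show ?thesis
    by (rule connected_complement_homeomorphic_convex_compact) auto
qed

text \<open>The inverse of the arc would embed a nonempty open planar set into the real line,
  against invariance of dimension.\<close>

lemma open_subset_arc_image_empty:
  fixes g :: "real \<Rightarrow> complex"
  assumes "arc g" "open S" "S \<subseteq> path_image g"
  shows "S = {}"
proof (rule ccontr)
  assume "S \<noteq> {}"
  obtain h where h: "homeomorphism {0..1} (path_image g) g h"
    using homeomorphism_arc[OF assms(1)] by blast
  have "continuous_on S h"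
    using h assms(3) continuous_on_subset unfolding homeomorphism_def by blast
  moreover have "inj_on h S"
    using h assms(3) unfolding homeomorphism_def by (metis inj_onI subsetD)
  ultimately have "DIM(complex) \<le> DIM(real)"
    using invariance_of_dimension[OF _ assms(2)] \<open>S \<noteq> {}\<close> by blast
  then show False by simp
qed

text \<open>A member that meets the path component of \<open>a\<close> lies inside it, so the
  members that meet it and those that miss it have disjoint unions, both compact by finiteness. This
  turns a failure of path-connectedness into the closed pieces that Janiszewski's theorem can
  handle.\<close>

lemma finite_union_path_connected_separation:
  fixes \<C> :: "'b::real_normed_vector set set"
  assumes "finite \<C>" and C: "\<And>C. C \<in> \<C> \<Longrightarrow> compact C \<and> path_connected C"
    and "a \<in> \<Union>\<C>" "b \<in> \<Union>\<C>" "\<not> path_component (\<Union>\<C>) a b"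
  obtains A B where "compact A" "compact B" "A \<union> B = \<Union>\<C>" "A \<inter> B = {}" "a \<in> A" "b \<in> B"
proof -
  define P where "P = path_component_set (\<Union>\<C>) a"
  define A where "A = \<Union>{C \<in> \<C>. C \<inter> P \<noteq> {}}"
  define B where "B = \<Union>{C \<in> \<C>. C \<inter> P = {}}"
  have CP: "C \<subseteq> P" if "C \<in> \<C>" "C \<inter> P \<noteq> {}" for C
  proof
    fix y assume "y \<in> C"
    obtain x where x: "x \<in> C" "path_component (\<Union>\<C>) a x"
      using \<open>C \<inter> P \<noteq> {}\<close> unfolding P_def by auto
    have "path_component C x y"
      using C[OF that(1)] x \<open>y \<in> C\<close> by (simp add: path_connected_component)
    then have "path_component (\<Union>\<C>) x y"
      using path_component_of_subset[of C "\<Union>\<C>"] that(1) by blast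
    then show "y \<in> P"
      unfolding P_def using x(2) path_component_trans by blast
  qed
  have "a \<in> P" using assms(3) unfolding P_def by (simp add: path_component_refl)
  show ?thesis
  proof
    show "compact A" "compact B"
      unfolding A_def B_def using assms(1) C by (auto intro!: compact_Union)
    show "A \<union> B = \<Union>\<C>" unfolding A_def B_def by auto
    show "A \<inter> B = {}" unfolding A_def B_def using CP by blast
    show "a \<in> A" unfolding A_def using \<open>a \<in> P\<close> assms(3) by auto
    show "b \<in> B"
    proof -
      have "b \<notin> P" using assms(5) unfolding P_def by simp
      moreover obtain C where "C \<in> \<C>" "b \<in> C" using assms(4) by blast
      ultimately show ?thesis unfolding B_def using CP by blast
    qed
  qed
qed

section \<open>Plane drawings and their edges\<close>

locale plane_drawing =
  fixes V :: "'a set" and E :: "'a set set"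
    and p :: "'a \<Rightarrow> complex" and \<gamma> :: "'a set \<Rightarrow> real \<Rightarrow> complex"
  assumes simple: "simple_graph V E"
    and inj: "inj_on p V"
    and arc: "e \<in> E \<Longrightarrow> arc (\<gamma> e)"
    and ends: "e \<in> E \<Longrightarrow> {pathstart (\<gamma> e), pathfinish (\<gamma> e)} = p ` e"
    and vertex_on: "e \<in> E \<Longrightarrow> v \<in> V \<Longrightarrow> p v \<in> path_image (\<gamma> e) \<Longrightarrow> v \<in> e"
    and meet: "e \<in> E \<Longrightarrow> e' \<in> E \<Longrightarrow> e \<noteq> e' \<Longrightarrow>
      path_image (\<gamma> e) \<inter> path_image (\<gamma> e') \<subseteq> p ` (e \<inter> e')"
begin

text \<open>The points of all of \<open>V\<close> are kept for every edge set \<open>D\<close>, so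
  that inserting an edge adds only its open arc and edges can be added one at a time.\<close>

definition drawing :: "'a set set \<Rightarrow> complex set" where
  "drawing D = p ` V \<union> (\<Union>e\<in>D. path_image (\<gamma> e))"

definition faces :: "'a set set \<Rightarrow> complex set set" where
  "faces D = components (- drawing D)"

definition open_edge :: "'a set \<Rightarrow> complex set" where
  "open_edge e = path_image (\<gamma> e) - p ` e"

text \<open>End points do not count: a face may touch them only through other edges or as isolated
  vertices.\<close>

definition borders :: "complex set \<Rightarrow> 'a set \<Rightarrow> bool" where
  "borders f e \<longleftrightarrow> frontier f \<inter> open_edge e \<noteq> {}"

lemma finite_V: "finite V" and finite_E: "finite E"
  and edge_subset: "e \<in> E \<Longrightarrow> e \<subseteq> V" and card_edge: "e \<in> E \<Longrightarrow> card e = 2"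
proof -
  show "finite V" using simple unfolding simple_graph_def by simp
  then have "finite (Pow V)" by simp
  moreover have "E \<subseteq> Pow V" using simple unfolding simple_graph_def by auto
  ultimately show "finite E" by (rule rev_finite_subset)
  show "e \<in> E \<Longrightarrow> e \<subseteq> V" "e \<in> E \<Longrightarrow> card e = 2"
    using simple unfolding simple_graph_def by auto
qed

lemma compact_drawing:
  assumes "D \<subseteq> E"
  shows "compact (drawing D)"
proof -
  have "finite D" using assms finite_E finite_subset by blast
  then show ?thesis
    unfolding drawing_def using assms arc finite_V
    by (intro compact_Un compact_UN) (auto intro!: finite_imp_compact compact_arc_image)
qed

lemma closed_drawing: "D \<subseteq> E \<Longrightarrow> closed (drawing D)"
  by (simp add: compact_drawing compact_imp_closed)

lemma drawing_insert: "drawing (insert e D) = path_image (\<gamma> e) \<union> drawing D"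
  unfolding drawing_def by auto

lemma drawing_mono: "D \<subseteq> D' \<Longrightarrow> drawing D \<subseteq> drawing D'"
  unfolding drawing_def by auto

lemma ends_in_path_image: "e \<in> E \<Longrightarrow> p ` e \<subseteq> path_image (\<gamma> e)"
  using ends[of e] by (metis insert_subset empty_subsetI pathstart_in_path_image pathfinish_in_path_image)

lemma path_image_Int_drawing:
  assumes "D \<subseteq> E" "e \<in> E" "e \<notin> D"
  shows "path_image (\<gamma> e) \<inter> drawing D = p ` e"
proof
  show "path_image (\<gamma> e) \<inter> drawing D \<subseteq> p ` e"
  proof
    fix x assume x: "x \<in> path_image (\<gamma> e) \<inter> drawing D"
    then consider v where "v \<in> V" "x = p v" | e' where "e' \<in> D" "x \<in> path_image (\<gamma> e')"
      unfolding drawing_def by auto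
    then show "x \<in> p ` e"
    proof cases
      case 1
      then show ?thesis using vertex_on[OF assms(2)] x by auto
    next
      case 2
      then show ?thesis using meet[of e e'] assms x by auto
    qed
  qed
  show "p ` e \<subseteq> path_image (\<gamma> e) \<inter> drawing D"
    using ends_in_path_image[OF assms(2)] edge_subset[OF assms(2)] unfolding drawing_def by auto
qed

lemma open_edge_disjoint_drawing:
  assumes "D \<subseteq> E" "e \<in> E" "e \<notin> D"
  shows "open_edge e \<inter> drawing D = {}"
  using path_image_Int_drawing[OF assms] unfolding open_edge_def by blast

lemma
  assumes "e \<in> E"
  shows connected_open_edge: "connected (open_edge e)" and open_edge_nonempty: "open_edge e \<noteq> {}"
  using connected_simple_path_endless[of "\<gamma> e"] nonempty_simple_path_endless[of "\<gamma> e"]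
    arc_imp_simple_path[OF arc[OF assms]] ends[OF assms] unfolding open_edge_def by simp_all

section \<open>Faces and the edges on their frontier\<close>

lemma face_props:
  assumes "D \<subseteq> E" "f \<in> faces D"
  shows "open f" "connected f" "f \<noteq> {}" "f \<subseteq> - drawing D" "frontier f \<subseteq> drawing D"
  using assms closed_drawing[OF assms(1)] in_components_connected[of f] in_components_nonempty[of f]
    in_components_subset[of f] frontier_of_components_closed_complement[of "drawing D" f]
    open_components[of "- drawing D" f]
  unfolding faces_def by auto

lemma faces_eqI:
  assumes "f \<in> faces D" "g \<in> faces D" "x \<in> f" "y \<in> g" "connected_component (- drawing D) x y"
  shows "f = g"
proof -
  have "f = connected_component_set (- drawing D) x" "g = connected_component_set (- drawing D) y"
    using assms unfolding faces_def components_iff by (metis connected_component_eq)+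
  then show ?thesis using assms(5) connected_component_eq by auto
qed

text \<open>A path in the drawing between the ends of \<open>e\<close> contains an arc
  \<open>\<beta>\<close>, and \<open>e\<close> meets the drawing only in its ends, so both arcs
  close up to a simple loop. The last conclusion, that the loop meets the drawing in a connected
  set, is the hypothesis of Janiszewski's theorem.\<close>

lemma jordan_loop:
  assumes "D \<subseteq> E" "e \<in> E" "e \<notin> D"
    and "path_component (drawing D) (pathstart (\<gamma> e)) (pathfinish (\<gamma> e))"
  obtains \<beta> c where "arc \<beta>" "path_image \<beta> \<subseteq> drawing D" "simple_path c" "pathfinish c = pathstart c"
    "path_image c = path_image (\<gamma> e) \<union> path_image \<beta>" "path_image c \<inter> drawing D = path_image \<beta>"
proof -
  obtain h where h: "path h" "path_image h \<subseteq> drawing D"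
    "pathstart h = pathfinish (\<gamma> e)" "pathfinish h = pathstart (\<gamma> e)"
    using path_component_sym[OF assms(4)] unfolding path_component_def by blast
  have ne: "pathfinish (\<gamma> e) \<noteq> pathstart (\<gamma> e)"
    using arc_distinct_ends[OF arc[OF assms(2)]] by simp
  obtain \<beta> where b: "arc \<beta>" "path_image \<beta> \<subseteq> path_image h"
    "pathstart \<beta> = pathfinish (\<gamma> e)" "pathfinish \<beta> = pathstart (\<gamma> e)"
    using path_contains_arc[OF h(1,3,4) ne] by blast
  have sub: "path_image \<beta> \<subseteq> drawing D" using b(2) h(2) by simp
  have int: "path_image (\<gamma> e) \<inter> drawing D = {pathstart (\<gamma> e), pathfinish (\<gamma> e)}"
    using path_image_Int_drawing[OF assms(1-3)] ends[OF assms(2)] by simp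
  show ?thesis
  proof
    show "arc \<beta>" "path_image \<beta> \<subseteq> drawing D" by fact+
    show "simple_path (\<gamma> e +++ \<beta>)"
      using b arc[OF assms(2)] int sub by (intro simple_path_join_loop) auto
    show "pathfinish (\<gamma> e +++ \<beta>) = pathstart (\<gamma> e +++ \<beta>)" using b by simp
    show pi: "path_image (\<gamma> e +++ \<beta>) = path_image (\<gamma> e) \<union> path_image \<beta>"
      using b by (simp add: path_image_join)
    have "{pathstart (\<gamma> e), pathfinish (\<gamma> e)} \<subseteq> path_image \<beta>"
      using b(3,4) pathstart_in_path_image[of \<beta>] pathfinish_in_path_image[of \<beta>] by simp
    then show "path_image (\<gamma> e +++ \<beta>) \<inter> drawing D = path_image \<beta>"
      unfolding pi using int sub by blast
  qed
qed

text \<open>Once \<open>e\<close> is deleted, each of the two faces reaches the open edge through a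
  small ball around a frontier point, and the open edge itself connects the two balls.\<close>

lemma bordering_faces_joined:
  assumes "D \<subseteq> E" "e \<in> E" "e \<notin> D"
    and "f \<in> faces (insert e D)" "g \<in> faces (insert e D)" "borders f e" "borders g e" "x \<in> f" "y \<in> g"
  shows "connected_component (- drawing D) x y"
proof -
  have inD: "insert e D \<subseteq> E" using assms by simp
  have *: "\<exists>w \<in> open_edge e. connected_component (- drawing D) x w"
    if f: "f \<in> faces (insert e D)" and "borders f e" "x \<in> f" for f x
  proof -
    obtain w where w: "w \<in> frontier f" "w \<in> open_edge e"
      using \<open>borders f e\<close> unfolding borders_def by auto
    have "open (- drawing D)" "w \<in> - drawing D"
      using closed_drawing[OF assms(1)] open_edge_disjoint_drawing[OF assms(1-3)] w by auto
    then obtain r where r: "r > 0" "ball w r \<subseteq> - drawing D"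
      using open_contains_ball by blast
    then obtain z where z: "z \<in> f" "z \<in> ball w r"
      using w(1) by (auto simp: frontier_straddle dist_commute)
    have "f \<subseteq> - drawing D"
      using face_props(4)[OF inD f] drawing_mono[of D "insert e D"] by auto
    then have "connected_component (- drawing D) x z"
      using face_props(2)[OF inD f] \<open>x \<in> f\<close> z(1) unfolding connected_component_def by blast
    moreover have "connected_component (- drawing D) z w"
      unfolding connected_component_def
      using r z(2) by (intro exI[of _ "ball w r"]) auto
    ultimately show ?thesis using w(2) connected_component_trans by blast
  qed
  obtain w where w: "w \<in> open_edge e" "connected_component (- drawing D) x w"
    using * assms by blast
  obtain w' where w': "w' \<in> open_edge e" "connected_component (- drawing D) y w'"
    using * assms by blast
  have "connected_component (- drawing D) w w'"
    unfolding connected_component_def using connected_open_edge[OF assms(2)] w w'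
      open_edge_disjoint_drawing[OF assms(1-3)] by (intro exI[of _ "open_edge e"]) auto
  then show ?thesis
    using w(2) connected_component_sym[OF w'(2)] connected_component_trans by metis
qed

text \<open>The old drawing splits into disjoint compact sets \<open>A\<close> and \<open>B\<close>,
  each containing one end of \<open>e\<close>. Janiszewski's theorem is applied twice, first to the
  arc and \<open>A\<close>, then to their union and \<open>B\<close>; both intersections are single
  points.\<close>

lemma bordering_faces_bridge:
  assumes "D \<subseteq> E" "e \<in> E" "e \<notin> D"
    and bridge: "\<not> path_component (drawing D) (pathstart (\<gamma> e)) (pathfinish (\<gamma> e))"
    and "connected_component (- drawing D) x y" "x \<notin> path_image (\<gamma> e)" "y \<notin> path_image (\<gamma> e)"
  shows "connected_component (- drawing (insert e D)) x y"
proof -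
  define \<C> where "\<C> = (\<lambda>v. {p v}) ` V \<union> (\<lambda>e. path_image (\<gamma> e)) ` D"
  have U: "\<Union>\<C> = drawing D" unfolding \<C>_def drawing_def by auto
  have int: "path_image (\<gamma> e) \<inter> drawing D = {pathstart (\<gamma> e), pathfinish (\<gamma> e)}"
    using path_image_Int_drawing[OF assms(1-3)] ends[OF assms(2)] by simp
  have "finite \<C>" unfolding \<C>_def using finite_V finite_subset[OF assms(1) finite_E] by simp
  moreover have "compact C \<and> path_connected C" if "C \<in> \<C>" for C
    using that arc assms(1) unfolding \<C>_def
    by (auto intro!: compact_arc_image path_connected_path_image arc_imp_path)
  ultimately obtain A B where AB: "compact A" "compact B" "A \<union> B = drawing D" "A \<inter> B = {}"
    "pathstart (\<gamma> e) \<in> A" "pathfinish (\<gamma> e) \<in> B"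
    using finite_union_path_connected_separation[of \<C> "pathstart (\<gamma> e)" "pathfinish (\<gamma> e)"]
      int bridge unfolding U by blast
  have AD: "connected_component (- A) x y" and BD: "connected_component (- B) x y"
    using assms(5) AB(3) by (auto elim!: connected_component_of_subset)
  have gD: "connected_component (- path_image (\<gamma> e)) x y"
    using connected_Compl_arc_image[OF arc[OF assms(2)]] assms(6,7)
    unfolding connected_component_def by blast
  have gA: "path_image (\<gamma> e) \<inter> A = {pathstart (\<gamma> e)}" using AB int by blast
  then have "connected_component (- (path_image (\<gamma> e) \<union> A)) x y"
    using Janiszewski[of "path_image (\<gamma> e)" A x y] gD AD AB(1) compact_arc_image[OF arc[OF assms(2)]]
    by (simp add: compact_imp_closed)
  moreover have "(path_image (\<gamma> e) \<union> A) \<inter> B = {pathfinish (\<gamma> e)}"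
  proof -
    have "(path_image (\<gamma> e) \<union> A) \<inter> B = path_image (\<gamma> e) \<inter> drawing D \<inter> B"
      using AB(3,4) by blast
    also have "\<dots> = {pathfinish (\<gamma> e)}" unfolding int using AB(4-6) by auto
    finally show ?thesis .
  qed
  moreover have "compact (path_image (\<gamma> e) \<union> A)"
    by (intro compact_Un AB compact_arc_image arc assms)
  ultimately have "connected_component (- ((path_image (\<gamma> e) \<union> A) \<union> B)) x y"
    by - (rule Janiszewski, simp_all add: BD AB compact_imp_closed)
  then show ?thesis unfolding drawing_insert AB(3)[symmetric] by (simp only: Un_assoc)
qed

text \<open>An injection of the bordering faces into \<open>bool\<close> gives finiteness and the
  bound 2 together. If \<open>e\<close> is a bridge, the bordering faces coincide and a constant map
  is injective; otherwise a face is mapped to its side of a loop through \<open>e\<close>.\<close>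

lemma card_bordering_faces:
  assumes "D \<subseteq> E" "e \<in> D"
  shows "finite {f \<in> faces D. borders f e}" "card {f \<in> faces D. borders f e} \<le> 2"
proof -
  define D' where "D' = D - {e}"
  have D': "D' \<subseteq> E" "e \<in> E" "e \<notin> D'" and D: "D = insert e D'"
    using assms unfolding D'_def by auto
  let ?F = "{f \<in> faces D. borders f e}"
  have outside_arc: "x \<notin> path_image (\<gamma> e)" if "x \<in> f" "f \<in> faces D" for x f
    using face_props(4)[OF assms(1) that(2)] that(1) unfolding D drawing_insert by auto
  have joined: "connected_component (- drawing D') x y"
    if "f \<in> ?F" "g \<in> ?F" "x \<in> f" "y \<in> g" for f g x y
    using bordering_faces_joined[OF D', of f g x y] that D by simp
  have "\<exists>\<sigma> :: complex set \<Rightarrow> bool. inj_on \<sigma> ?F"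
  proof (cases "path_component (drawing D') (pathstart (\<gamma> e)) (pathfinish (\<gamma> e))")
    case False
    have "f = g" if "f \<in> ?F" "g \<in> ?F" for f g
    proof -
      have "f \<noteq> {}" "g \<noteq> {}" using face_props(3)[OF assms(1)] that by auto
      then obtain x y where "x \<in> f" "y \<in> g" by blast
      then show ?thesis
        using faces_eqI[of f D g x y] bordering_faces_bridge[OF D' False joined[OF that]] that
          outside_arc D by blast
    qed
    then have "inj_on (\<lambda>_. True) ?F" by (intro inj_onI) blast
    then show ?thesis by blast
  next
    case True
    obtain \<beta> c where b: "arc \<beta>" and c: "simple_path c" "pathfinish c = pathstart c"
      and pc: "path_image c = path_image (\<gamma> e) \<union> path_image \<beta>"
      and bD: "path_image \<beta> \<subseteq> drawing D'" and cD: "path_image c \<inter> drawing D' = path_image \<beta>"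
      using jordan_loop[OF D' True] by metis
    have cDD: "path_image c \<union> drawing D' = drawing D"
      using pc bD unfolding D drawing_insert by auto
    note J = Jordan_inside_outside[OF c]
    have inout: "inside (path_image c) \<union> outside (path_image c) = - path_image c"
      "inside (path_image c) \<inter> outside (path_image c) = {}"
      "open (inside (path_image c))" "open (outside (path_image c))"
      "connected (inside (path_image c))" "connected (outside (path_image c))"
      using J by simp_all
    \<comment> \<open>The loop meets the rest of the drawing in an arc, so by Janiszewski's theorem two
      bordering faces on the same side of the loop coincide.\<close>
    have "inj_on (\<lambda>f. f \<subseteq> inside (path_image c)) ?F"
    proof (rule inj_onI)
      fix f g assume fg: "f \<in> ?F" "g \<in> ?F"
        and same: "(f \<subseteq> inside (path_image c)) = (g \<subseteq> inside (path_image c))"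
      have side: "f \<subseteq> inside (path_image c) \<or> f \<subseteq> outside (path_image c)" if "f \<in> ?F" for f
      proof -
        have "f \<subseteq> inside (path_image c) \<union> outside (path_image c)"
          using that face_props(4)[OF assms(1), of f] cDD unfolding inout(1) by auto
        moreover have "connected f" using that face_props(2)[OF assms(1)] by simp
        ultimately show ?thesis
          using connectedD[of f "inside (path_image c)" "outside (path_image c)"] inout(2-4) by blast
      qed
      have "f \<noteq> {}" "g \<noteq> {}" using face_props(3)[OF assms(1)] fg by auto
      then obtain x y where xy: "x \<in> f" "y \<in> g" by blast
      have "\<exists>S. connected S \<and> S \<subseteq> - path_image c \<and> x \<in> S \<and> y \<in> S"
      proof (cases "f \<subseteq> inside (path_image c)")
        case True
        then have "x \<in> inside (path_image c)" "y \<in> inside (path_image c)" using same xy by auto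
        then show ?thesis using inout(1,5) by blast
      next
        case False
        then have "f \<subseteq> outside (path_image c)" "g \<subseteq> outside (path_image c)"
          using same side fg by blast+
        then show ?thesis using inout(1,6) xy by blast
      qed
      then have "connected_component (- path_image c) x y" unfolding connected_component_def .
      then have "connected_component (- (path_image c \<union> drawing D')) x y"
        using Janiszewski[of "path_image c" "drawing D'" x y] joined[OF fg xy] cD b
          closed_drawing[OF D'(1)] compact_simple_path_image[OF c(1)] connected_arc_image by metis
      then show "f = g"
        using faces_eqI[of f D g x y] fg xy cDD by simp
    qed
    then show ?thesis by blast
  qed
  then obtain \<sigma> :: "complex set \<Rightarrow> bool" where "inj_on \<sigma> ?F" by blast
  then show "finite ?F" "card ?F \<le> 2"
    using inj_on_finite[of \<sigma> ?F UNIV] card_inj_on_le[of \<sigma> ?F UNIV] by simp_all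
qed

section \<open>Faces with few bordering edges, and double counting\<close>

lemma connected_Compl_two_edges:
  assumes "T \<subseteq> E" "card T \<le> 2"
  shows "connected (- drawing T)"
proof -
  let ?A = "\<Union>e\<in>T. path_image (\<gamma> e)"
  have finT: "finite T" using assms(1) finite_E finite_subset by blast
  have op: "open (- ?A)"
    using finT assms(1) arc by (auto intro!: compact_imp_closed compact_UN compact_arc_image)
  have "connected (- ?A)"
  proof -
    consider "T = {}" | e where "T = {e}" | e e' where "T = {e, e'}" "e \<noteq> e'"
    proof -
      have "card T = 0 \<or> card T = 1 \<or> card T = 2" using assms(2) by linarith
      then show ?thesis using that finT by (metis card_0_eq card_1_singletonE card_2_iff)
    qed
    then show ?thesis
    proof cases
      case 1
      then show ?thesis by (simp add: connected_UNIV)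
    next
      case 2
      then show ?thesis using connected_Compl_arc_image[OF arc] assms(1) by simp
    next
      case 3
      then have ee: "e \<in> E" "e' \<in> E" using assms(1) by auto
      \<comment> \<open>Distinct edges of a simple graph share at most one vertex, so their arcs
        meet in a connected set (empty or one point), as Janiszewski's theorem requires.\<close>
      have "e \<inter> e' \<subset> e"
        using 3(2) card_edge[OF ee(1)] card_edge[OF ee(2)]
        by (metis Int_lower2 card_subset_eq card.infinite inf.absorb_iff1 inf.orderE psubsetI inf_le1 zero_neq_numeral)
      then have "card (e \<inter> e') < 2"
        using card_edge[OF ee(1)] finite_V edge_subset[OF ee(1)]
        by (metis finite_subset psubset_card_mono)
      then have "card (e \<inter> e') = 0 \<or> card (e \<inter> e') = 1" by linarith
      moreover have "finite (e \<inter> e')" using finite_V edge_subset[OF ee(1)] finite_subset by blast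
      ultimately have "e \<inter> e' = {} \<or> (\<exists>v. e \<inter> e' = {v})"
        by (metis card_0_eq card_1_singletonE)
      then have "connected (p ` (e \<inter> e'))" by auto
      moreover have "path_image (\<gamma> e) \<inter> path_image (\<gamma> e') = p ` (e \<inter> e')"
        using meet[OF ee 3(2)] ends_in_path_image[OF ee(1)] ends_in_path_image[OF ee(2)] by blast
      ultimately have int: "connected (path_image (\<gamma> e) \<inter> path_image (\<gamma> e'))" by simp
      have A: "?A = path_image (\<gamma> e) \<union> path_image (\<gamma> e')" using 3 by auto
      have one: "connected_component (- path_image (\<gamma> d)) x y"
        if "d \<in> E" "x \<notin> path_image (\<gamma> d)" "y \<notin> path_image (\<gamma> d)" for d x y
        using connected_Compl_arc_image[OF arc[OF that(1)]] that(2,3)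
        unfolding connected_component_def by blast
      have "connected_component (- ?A) x y" if "x \<in> - ?A" "y \<in> - ?A" for x y
        unfolding A
        by (rule Janiszewski[OF _ _ int])
          (use that A ee one arc in \<open>auto intro: compact_arc_image closed_arc_image\<close>)
      then show ?thesis using connected_iff_connected_component by blast
    qed
  qed
  \<comment> \<open>The remaining vertices are finitely many points; removing them from a connected
    open set of the plane leaves it connected.\<close>
  then have "connected (- ?A - p ` V)"
    using finite_V op by (intro connected_open_diff_countable) (auto intro: countable_finite)
  moreover have "- ?A - p ` V = - drawing T" unfolding drawing_def by auto
  ultimately show ?thesis by simp
qed

text \<open>The frontier of \<open>f\<close> lies in the drawing of the bordering edges alone. The
  complement of that smaller drawing is connected, contains \<open>f\<close> and misses its
  frontier, hence equals \<open>f\<close>; every face of \<open>D\<close> lies in this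
  complement.\<close>

lemma face_with_few_edges:
  assumes "D \<subseteq> E" "f \<in> faces D" "card {e \<in> D. borders f e} \<le> 2"
  shows "faces D = {f}"
proof -
  define T where "T = {e \<in> D. borders f e}"
  have T: "T \<subseteq> E" "T \<subseteq> D" using assms(1) unfolding T_def by auto
  have "frontier f \<subseteq> drawing T"
  proof
    fix x assume x: "x \<in> frontier f"
    then have "x \<in> drawing D" using face_props(5)[OF assms(1,2)] by auto
    then consider "x \<in> p ` V" | e where "e \<in> D" "x \<in> path_image (\<gamma> e)" "x \<notin> p ` V"
      unfolding drawing_def by auto
    then show "x \<in> drawing T"
    proof cases
      case 1
      then show ?thesis unfolding drawing_def by simp
    next
      case 2
      then have "x \<in> open_edge e" unfolding open_edge_def using edge_subset assms(1) by blast
      then have "e \<in> T" using x 2 unfolding T_def borders_def by auto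
      then show ?thesis using 2 unfolding drawing_def by auto
    qed
  qed
  moreover have "f \<subseteq> - drawing T"
    using face_props(4)[OF assms(1,2)] drawing_mono[OF T(2)] by auto
  ultimately have "- drawing T \<subseteq> f"
    using connected_Int_frontier[OF connected_Compl_two_edges[OF T(1)], of f]
      face_props(3)[OF assms(1,2)] assms(3) unfolding T_def by blast
  then have "g \<subseteq> f" if "g \<in> faces D" for g
    using face_props(4)[OF assms(1) that] drawing_mono[OF T(2)] by auto
  then have "g = f" if "g \<in> faces D" for g
    using that assms(2) face_props(3)[OF assms(1) that] components_eq[of g "- drawing D" f]
    unfolding faces_def by blast
  then show ?thesis using assms(2) by blast
qed

text \<open>Unless there is only one face, every face borders some edge, and each of the finitely
  many edges borders finitely many faces.\<close>

lemma finite_faces: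
  assumes "D \<subseteq> E"
  shows "finite (faces D)"
proof (cases "\<exists>f. faces D = {f}")
  case True
  then show ?thesis by auto
next
  case False
  have "faces D \<subseteq> (\<Union>e\<in>D. {f \<in> faces D. borders f e})"
  proof
    fix f assume f: "f \<in> faces D"
    then have "\<not> card {e \<in> D. borders f e} \<le> 2"
      using face_with_few_edges[OF assms f] False by blast
    then have "{e \<in> D. borders f e} \<noteq> {}" by (metis card.empty zero_le)
    then show "f \<in> (\<Union>e\<in>D. {f \<in> faces D. borders f e})" using f by auto
  qed
  moreover have "finite (\<Union>e\<in>D. {f \<in> faces D. borders f e})"
    using card_bordering_faces(1)[OF assms] assms finite_E finite_subset by blast
  ultimately show ?thesis by (rule finite_subset)
qed

text \<open>Double counting of bordering pairs: a second face forces at least three edges on each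
  face, while each edge borders at most two faces.\<close>

lemma three_faces_le_two_edges:
  assumes "D \<subseteq> E" "card (faces D) \<ge> 2"
  shows "3 * card (faces D) \<le> 2 * card D"
proof -
  have finD: "finite D" using assms(1) finite_E finite_subset by blast
  have "3 \<le> card {e \<in> D. borders f e}" if "f \<in> faces D" for f
    using face_with_few_edges[OF assms(1) that] assms(2)
    by (cases "card {e \<in> D. borders f e} \<le> 2") auto
  then have "card (faces D) * 3 \<le> (\<Sum>f\<in>faces D. card {e \<in> D. borders f e})"
    using sum_bounded_below[of "faces D" 3 "\<lambda>f. card {e \<in> D. borders f e}"] by simp
  also have "\<dots> = (\<Sum>e\<in>D. card {f \<in> faces D. borders f e})"
    using finD finite_faces[OF assms(1)] by (intro sum_multicount_gen) auto
  also have "\<dots> \<le> card D * 2"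
    using sum_bounded_above[of D "\<lambda>e. card {f \<in> faces D. borders f e}" 2]
      card_bordering_faces(2)[OF assms(1)] by simp
  finally show ?thesis by simp
qed

section \<open>Euler's inequality and the edge bound\<close>

lemma faces_insert_edge:
  assumes "D \<subseteq> E" "e \<in> E" "e \<notin> D"
  obtains \<phi> where "\<phi> ` faces (insert e D) = faces D"
    "\<And>f. f \<in> faces (insert e D) \<Longrightarrow> f \<subseteq> \<phi> f"
proof -
  let ?D = "insert e D"
  have D': "?D \<subseteq> E" using assms by simp
  have mono: "- drawing ?D \<subseteq> - drawing D" unfolding drawing_insert by auto
  have "\<exists>g \<in> faces D. f \<subseteq> g" if "f \<in> faces ?D" for f
    using exists_component_superset[of f "- drawing D"] face_props[OF D' that] mono
    unfolding faces_def by (metis subset_empty subset_trans)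
  then obtain \<phi> where \<phi>: "\<And>f. f \<in> faces ?D \<Longrightarrow> \<phi> f \<in> faces D \<and> f \<subseteq> \<phi> f" by metis
  \<comment> \<open>Surjectivity: an open face is not covered by the arc of \<open>e\<close>, so
    some point of it survives in a new face.\<close>
  have "g \<in> \<phi> ` faces ?D" if g: "g \<in> faces D" for g
  proof -
    have "\<not> g \<subseteq> path_image (\<gamma> e)"
      using open_subset_arc_image_empty[OF arc[OF assms(2)]] face_props[OF assms(1) g] by blast
    then obtain x where x: "x \<in> g" "x \<notin> path_image (\<gamma> e)" by auto
    then have "x \<in> - drawing ?D"
      using face_props(4)[OF assms(1) g] unfolding drawing_insert by auto
    then obtain f where f: "f \<in> faces ?D" "x \<in> f"
      unfolding faces_def by (metis UnionE Union_components)
    then have "\<phi> f = g"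
      using \<phi>[OF f(1)] g x(1) components_eq[of "\<phi> f" "- drawing D" g] unfolding faces_def by blast
    then show ?thesis using f(1) by blast
  qed
  then have "\<phi> ` faces ?D = faces D" using \<phi> by blast
  then show ?thesis using that \<phi> by blast
qed

lemma card_faces_insert_ge:
  assumes "D \<subseteq> E" "e \<in> E" "e \<notin> D"
  shows "card (faces D) \<le> card (faces (insert e D))"
proof -
  obtain \<phi> where "\<phi> ` faces (insert e D) = faces D"
    using faces_insert_edge[OF assms] by metis
  then show ?thesis
    using card_image_le[OF finite_faces[of "insert e D"], of \<phi>] assms by simp
qed

text \<open>Near an interior point of \<open>e\<close> there are points inside and outside the
  Jordan loop through \<open>e\<close>. They lie in different new faces but, within a ball that
  avoids the old drawing, in the same old face. So the surjection from new to old faces is not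
  injective.\<close>

lemma card_faces_insert_cycle:
  assumes "D \<subseteq> E" "e \<in> E" "e \<notin> D"
    and "path_component (drawing D) (pathstart (\<gamma> e)) (pathfinish (\<gamma> e))"
  shows "card (faces D) < card (faces (insert e D))"
proof -
  let ?D = "insert e D"
  have D': "?D \<subseteq> E" using assms by simp
  obtain \<phi> where \<phi>: "\<phi> ` faces ?D = faces D" "\<And>f. f \<in> faces ?D \<Longrightarrow> f \<subseteq> \<phi> f"
    using faces_insert_edge[OF assms(1-3)] by metis
  obtain \<beta> c where c: "simple_path c" "pathfinish c = pathstart c"
    and pc: "path_image c = path_image (\<gamma> e) \<union> path_image \<beta>" and bD: "path_image \<beta> \<subseteq> drawing D"
    using jordan_loop[OF assms] by metis
  note J = Jordan_inside_outside[OF c]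
  obtain x where x: "x \<in> open_edge e" using open_edge_nonempty[OF assms(2)] by auto
  then have xc: "x \<in> path_image c" using pc unfolding open_edge_def by auto
  have "x \<in> - drawing D" using open_edge_disjoint_drawing[OF assms(1-3)] x by auto
  then obtain r where r: "r > 0" "ball x r \<subseteq> - drawing D"
    using closed_drawing[OF assms(1)] open_contains_ball[of "- drawing D"] by auto
  have "x \<in> frontier (inside (path_image c))" "x \<in> frontier (outside (path_image c))"
    using J xc by simp_all
  then obtain y z where y: "y \<in> inside (path_image c)" "y \<in> ball x r"
    and z: "z \<in> outside (path_image c)" "z \<in> ball x r"
    using r(1) by (auto simp: frontier_straddle) (metis dist_commute)+
  have inout: "inside (path_image c) \<union> outside (path_image c) = - path_image c"
    "inside (path_image c) \<inter> outside (path_image c) = {}"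
    using J by simp_all
  then have "y \<in> - path_image c" "z \<in> - path_image c" using y(1) z(1) by blast+
  then have "y \<in> - drawing ?D" "z \<in> - drawing ?D"
    using y z r(2) pc unfolding drawing_insert by auto
  then obtain f g where f: "f \<in> faces ?D" "y \<in> f" and g: "g \<in> faces ?D" "z \<in> g"
    unfolding faces_def by (metis UnionE Union_components)
  have "f \<noteq> g"
  proof
    assume "f = g"
    have "path_image c \<subseteq> drawing ?D" using pc bD unfolding drawing_insert by auto
    then have "f \<subseteq> inside (path_image c) \<union> outside (path_image c)"
      using face_props(4)[OF D' f(1)] unfolding inout(1) by auto
    moreover have "connected f" "y \<in> f" "z \<in> f"
      using f g face_props(2)[OF D' f(1)] \<open>f = g\<close> by simp_all
    ultimately show False
      using connectedD[of f "inside (path_image c)" "outside (path_image c)"] J inout(2) y(1) z(1)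
      by blast
  qed
  moreover have "\<phi> f = \<phi> g"
  proof (rule faces_eqI)
    show "\<phi> f \<in> faces D" "\<phi> g \<in> faces D" using \<phi>(1) f g by auto
    show "y \<in> \<phi> f" "z \<in> \<phi> g" using \<phi>(2) f g by auto
    show "connected_component (- drawing D) y z"
      unfolding connected_component_def using r y z by (intro exI[of _ "ball x r"]) auto
  qed
  ultimately have "\<not> inj_on \<phi> (faces ?D)" using f g by (meson inj_onD)
  then have "card (\<phi> ` faces ?D) \<noteq> card (faces ?D)"
    using eq_card_imp_inj_on finite_faces[OF D'] by blast
  then show ?thesis
    using card_image_le[OF finite_faces[OF D'], of \<phi>] \<phi>(1) by simp
qed

text \<open>The labelling \<open>l\<close> plays the role of the components of the graph: equal labels imply
  connectedness, and the number of labels replaces the number of components in Euler's formula.\<close>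

lemma euler_lower_bound:
  assumes "D \<subseteq> E"
  shows "\<exists>l :: 'a \<Rightarrow> 'a. (\<forall>u\<in>V. \<forall>v\<in>V. l u = l v \<longrightarrow> path_component (drawing D) (p u) (p v)) \<and>
    card D + card (l ` V) + 1 \<le> card (faces D) + card V"
proof -
  have "finite D" using assms finite_E finite_subset by blast
  then show ?thesis using assms
  proof (induction D rule: finite_induct)
    case empty
    have "faces {} \<noteq> {}"
    proof -
      have "drawing {} \<noteq> UNIV"
        using compact_drawing[of "{}"] not_compact_UNIV by fastforce
      then show ?thesis unfolding faces_def by auto
    qed
    then have "card (faces {}) \<ge> 1"
      using finite_faces[of "{}"] by (simp add: Suc_le_eq card_gt_0_iff)
    \<comment> \<open>With \<open>id\<close> as labelling there are \<open>card V\<close> labels,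
      and one face accounts for the summand 1.\<close>
    then show ?case
      by (intro exI[of _ id]) (auto simp: path_component_refl drawing_def)
  next
    case (insert e D)
    have e: "D \<subseteq> E" "e \<in> E" "e \<notin> D" using insert by auto
    from insert.IH[OF e(1)] obtain l :: "'a \<Rightarrow> 'a" where
      l': "\<forall>u\<in>V. \<forall>v\<in>V. l u = l v \<longrightarrow> path_component (drawing D) (p u) (p v)"
      and le: "card D + card (l ` V) + 1 \<le> card (faces D) + card V" by (elim exE conjE)
    have l: "path_component (drawing D) (p u) (p v)" if "u \<in> V" "v \<in> V" "l u = l v" for u v
      using l' that by simp
    obtain a b where ab: "e = {a, b}" "pathstart (\<gamma> e) = p a" "pathfinish (\<gamma> e) = p b"
    proof -
      obtain a b where "e = {a, b}" using card_edge[OF e(2)] by (auto simp: card_2_iff)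
      then have "{pathstart (\<gamma> e), pathfinish (\<gamma> e)} = {p a, p b}" using ends[OF e(2)] by simp
      then have "(pathstart (\<gamma> e) = p a \<and> pathfinish (\<gamma> e) = p b) \<or>
        (pathstart (\<gamma> e) = p b \<and> pathfinish (\<gamma> e) = p a)" by (auto simp: doubleton_eq_iff)
      then show ?thesis using that \<open>e = {a, b}\<close> by (metis insert_commute)
    qed
    have abV: "a \<in> V" "b \<in> V" using edge_subset[OF e(2)] ab by auto
    have mono: "path_component (drawing (insert e D)) x y" if "path_component (drawing D) x y" for x y
      using that path_component_of_subset[OF drawing_mono[of D "insert e D"]] by blast
    show ?case
    proof (cases "l a = l b")
      case True
      \<comment> \<open>The ends are already connected, so the additional edge is paid for by an
        additional face.\<close>
      then have "card (faces D) < card (faces (insert e D))"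
        using card_faces_insert_cycle[OF e] l[OF abV] ab by simp
      then show ?thesis
        using l le mono insert(1,2) by (intro exI[of _ l]) auto
    next
      case False
      \<comment> \<open>The class of \<open>a\<close> is merged into that of \<open>b\<close>. The
        label \<open>l a\<close> disappears, and this pays for the additional edge.\<close>
      define l' where "l' = (\<lambda>v. if l v = l a then l b else l v)"
      have ab_joined: "path_component (drawing (insert e D)) (p a) (p b)"
      proof -
        have "path_component (path_image (\<gamma> e)) (p a) (p b)"
          unfolding path_component_def using ab arc_imp_path[OF arc[OF e(2)]] by blast
        then show ?thesis
          using path_component_of_subset[of "path_image (\<gamma> e)"] unfolding drawing_insert by blast
      qed
      have "path_component (drawing (insert e D)) (p u) (p v)"
        if "u \<in> V" "v \<in> V" "l' u = l' v" for u v
      proof -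
        have lu: "path_component (drawing (insert e D)) (p u) (p v)" if "u \<in> V" "v \<in> V" "l u = l v" for u v
          using mono l that by blast
        consider "l u = l v" | "l u = l a" "l v = l b" | "l v = l a" "l u = l b"
          using \<open>l' u = l' v\<close> unfolding l'_def by (auto split: if_splits)
        then show ?thesis
        proof cases
          case 1
          then show ?thesis using lu that by blast
        next
          case 2
          then show ?thesis
            using lu[of u a] lu[of b v] ab_joined that abV path_component_trans by metis
        next
          case 3
          then show ?thesis
            using lu[of u b] lu[of a v] path_component_sym[OF ab_joined] that abV path_component_trans
            by metis
        qed
      qed
      moreover have "card (l' ` V) + 1 \<le> card (l ` V)"
      proof -
        have "l' ` V \<subseteq> l ` V - {l a}" using abV False unfolding l'_def by auto
        then have "card (l' ` V) \<le> card (l ` V - {l a})" using finite_V by (intro card_mono) auto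
        also have "\<dots> < card (l ` V)" using finite_V abV by (intro psubset_card_mono) auto
        finally show ?thesis by simp
      qed
      ultimately show ?thesis
        using le card_faces_insert_ge[OF e] insert(1,2) by (intro exI[of _ l']) auto
    qed
  qed
qed

text \<open>Euler's inequality with at least one label gives |E| + 2 \<le> |F| + |V|. For two or
  more faces 3|F| \<le> 2|E| finishes the proof; otherwise |E| < |V|, which suffices for |V| \<ge>
  3.\<close>

lemma card_edges_le:
  assumes "card V \<ge> 3"
  shows "card E + 6 \<le> 3 * card V"
proof -
  obtain l :: "'a \<Rightarrow> 'a" where "card E + card (l ` V) + 1 \<le> card (faces E) + card V"
    using euler_lower_bound[of E] by blast
  moreover have "card (l ` V) \<ge> 1"
    using assms finite_V by (auto simp: Suc_le_eq card_gt_0_iff)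
  ultimately have "card E + 2 \<le> card (faces E) + card V" by simp
  then show ?thesis
    using three_faces_le_two_edges[of E] assms by (cases "card (faces E) \<ge> 2") auto
qed

end

lemma planar_card_edges:
  fixes V :: "'a set" and E :: "'a set set"
  assumes "simple_graph V E" "planar V E" "card V \<ge> 3"
  shows "card E + 6 \<le> 3 * card V"
proof -
  obtain p and \<gamma> :: "'a set \<Rightarrow> real \<Rightarrow> complex" where
    "inj_on p V"
    "\<forall>e\<in>E. arc (\<gamma> e) \<and> {pathstart (\<gamma> e), pathfinish (\<gamma> e)} = p ` e"
    "\<forall>e\<in>E. \<forall>v\<in>V. p v \<in> path_image (\<gamma> e) \<longrightarrow> v \<in> e"
    "\<forall>e\<in>E. \<forall>e'\<in>E. e \<noteq> e' \<longrightarrow> path_image (\<gamma> e) \<inter> path_image (\<gamma> e') \<subseteq> p ` (e \<inter> e')"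
    using assms(2) unfolding planar_def by (elim exE conjE)
  then have "plane_drawing V E p \<gamma>"
    using assms(1) by (intro plane_drawing.intro) (assumption | blast)+
  then show ?thesis by (rule plane_drawing.card_edges_le) (rule assms(3))
qed

section \<open>Interval colourings\<close>

lemma interval_colouringD:
  "interval_colouring V E c \<Longrightarrow> v \<in> V \<Longrightarrow> \<exists>a b. c ` incident_edges E v = {a..b}"
  unfolding interval_colouring_def by simp

text \<open>Restricting the edges intersects the colour set at each vertex with \<open>I\<close>,
  which will be an initial or a final segment. Empty intersections are included as intervals with
  \<open>b' < a'\<close>.\<close>

lemma interval_colouring_restrict:
  assumes "interval_colouring V E c" and "W \<subseteq> V"
    and "\<And>a b. \<exists>a' b'. {a..b} \<inter> I = {a'..b'}"
  shows "interval_colouring W {e \<in> E. c e \<in> I} c"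
proof -
  have "\<exists>a b. c ` incident_edges {e \<in> E. c e \<in> I} v = {a..b}" if "v \<in> W" for v
  proof -
    obtain a b where "c ` incident_edges E v = {a..b}"
      using interval_colouringD[OF assms(1)] assms(2) \<open>v \<in> W\<close> by blast
    moreover have "c ` incident_edges {e \<in> E. c e \<in> I} v = c ` incident_edges E v \<inter> I"
      unfolding incident_edges_def by auto
    ultimately show ?thesis
      using assms(3)[of a b] by simp
  qed
  then show ?thesis
    using assms(1) unfolding interval_colouring_def by simp
qed

lemma planar_subgraph:
  fixes V W :: "'a set" and D E :: "'a set set"
  assumes "planar V E" "W \<subseteq> V" "D \<subseteq> E"
  shows "planar W D"
proof -
  obtain p and \<gamma> :: "'a set \<Rightarrow> real \<Rightarrow> complex" where
    "inj_on p V"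
    "\<forall>e\<in>E. arc (\<gamma> e) \<and> {pathstart (\<gamma> e), pathfinish (\<gamma> e)} = p ` e"
    "\<forall>e\<in>E. \<forall>v\<in>V. p v \<in> path_image (\<gamma> e) \<longrightarrow> v \<in> e"
    "\<forall>e\<in>E. \<forall>e'\<in>E. e \<noteq> e' \<longrightarrow> path_image (\<gamma> e) \<inter> path_image (\<gamma> e') \<subseteq> p ` (e \<inter> e')"
    using assms(1) unfolding planar_def by (elim exE conjE)
  then show ?thesis
    unfolding planar_def using assms(2,3) inj_on_subset[of p V W]
    by (intro exI[of _ p] exI[of _ \<gamma>] conjI ballI) (meson subsetD)+
qed

lemma simple_graph_finite_edges: "simple_graph V E \<Longrightarrow> finite E"
  unfolding simple_graph_def by (meson Pow_iff finite_Pow_iff finite_subset subsetI)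

section \<open>Counting colours\<close>

lemma card_edges_two_vertices:
  assumes "simple_graph V E" "card V = 2"
  shows "card E \<le> 1"
proof -
  have "E \<subseteq> {V}"
    using assms unfolding simple_graph_def by (metis card_subset_eq singleton_iff subsetI)
  then show ?thesis
    using card_mono[of "{V}" E] by simp
qed

text \<open>Each colour class outside \<open>{p, q}\<close> has at least two edges, and each exempt
  colour that occurs has at least one, which costs at most 2 in total. Intersecting with
  \<open>{p, q}\<close> also covers \<open>p = q\<close> and exempt colours that do not
  occur.\<close>

lemma card_colours_le:
  assumes "finite E"
    and rep: "\<And>i. i \<in> c ` E \<Longrightarrow> i \<noteq> (p::nat) \<Longrightarrow> i \<noteq> q \<Longrightarrow> card {e \<in> E. c e = i} \<noteq> 1"
  shows "2 * card (c ` E) \<le> card E + 2"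
proof -
  let ?N = "\<lambda>i. card {e \<in> E. c e = i}"
  let ?M = "c ` E - {p, q}"
  have fin: "finite (c ` E)" using assms(1) by simp
  have ge1: "1 \<le> ?N i" if "i \<in> c ` E" for i
    using that \<open>finite E\<close> by (auto simp: Suc_le_eq card_gt_0_iff)
  have ge2: "2 \<le> ?N i" if "i \<in> ?M" for i
    using ge1[of i] rep[of i] that by force
  have "card E = (\<Sum>i\<in>c ` E. ?N i)"
    using sum.group[of E "c ` E" c "\<lambda>_. 1::nat"] \<open>finite E\<close> by simp
  also have "\<dots> = (\<Sum>i\<in>?M. ?N i) + (\<Sum>i\<in>c ` E \<inter> {p, q}. ?N i)"
    using sum.Int_Diff[OF fin, of ?N "{p, q}"] by simp
  also have "\<dots> \<ge> 2 * card ?M + card (c ` E \<inter> {p, q})"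
    using sum_bounded_below[of ?M 2 ?N, OF ge2] sum_bounded_below[of "c ` E \<inter> {p, q}" 1 ?N] ge1
    by (simp add: mult.commute add_mono)
  finally have "2 * card ?M + card (c ` E \<inter> {p, q}) \<le> card E" .
  moreover have "card (c ` E) = card ?M + card (c ` E \<inter> {p, q})"
    using fin by (metis Int_Diff_Un Int_Diff_disjoint add.commute card_Un_disjoint finite_Diff finite_Int)
  moreover have "card (c ` E \<inter> {p, q}) \<le> 2"
    by (rule order_trans[OF card_mono[of "{p, q}"]]) (auto simp: card_insert_if)
  ultimately show ?thesis by linarith
qed

text \<open>Twice the claimed bound, written without subtraction or fractions in \<open>nat\<close>,
  and for an arbitrary interval colouring, so that the induction can restrict the same
  \<open>c\<close> to subgraphs.\<close>

lemma colours_bound: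
  assumes "simple_graph V E" "planar V E" "interval_colouring V E c" "card V \<ge> 2"
  shows "2 * card (c ` E) + 4 \<le> 3 * card V"
  using assms
proof (induction "card E" arbitrary: V E rule: less_induct)
  case less
  have finE: "finite E" and finV: "finite V"
    using less.prems(1) simple_graph_finite_edges unfolding simple_graph_def by blast+
  show ?case
  proof (cases "\<exists>i \<in> c ` E. i \<noteq> Min (c ` E) \<and> i \<noteq> Max (c ` E) \<and> card {e \<in> E. c e = i} = 1")
    case False
    then have two: "2 * card (c ` E) \<le> card E + 2"
      using card_colours_le[OF finE, of c "Min (c ` E)" "Max (c ` E)"] by blast
    \<comment> \<open>The bound 3n - 6 fails for a single edge on two vertices; there at most one
      colour occurs, and 2 + 4 = 3 * 2.\<close>
    show ?thesis
    proof (cases "card V = 2")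
      case True
      then show ?thesis
        using card_edges_two_vertices[OF less.prems(1)] card_image_le[OF finE, of c] by simp
    next
      case False
      then show ?thesis
        using planar_card_edges[OF less.prems(1,2)] less.prems(4) two by simp
    qed
  next
    case True
    then obtain i uv where i: "i \<in> c ` E" "i \<noteq> Min (c ` E)" "i \<noteq> Max (c ` E)"
      and uv: "{e \<in> E. c e = i} = {uv}"
      by (auto simp: card_1_singleton_iff)
    have uvE: "uv \<in> E" "c uv = i" using uv by auto
    have card_uv: "card uv = 2" "uv \<subseteq> V"
      using less.prems(1) uvE unfolding simple_graph_def by auto
    \<comment> \<open>The induction hypothesis for both halves at once. The vertex set is cut down
      to the covered vertices, so that the two orders overlap only in \<open>uv\<close>. The colour
      \<open>j\<close> outside \<open>I\<close> makes the edge set smaller, and \<open>uv\<close>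
      provides the two vertices required.\<close>
    have side: "2 * card (c ` E') + 4 \<le> 3 * card (\<Union>E')"
      if E': "E' = {e \<in> E. c e \<in> I}" and I: "\<And>a b::nat. \<exists>a' b'. {a..b} \<inter> I = {a'..b'}"
        and "i \<in> I" and j: "j \<in> c ` E - I" for E' I j
    proof (rule less.hyps)
      have WV: "\<Union>E' \<subseteq> V" and EE: "E' \<subseteq> E"
        using less.prems(1) unfolding E' simple_graph_def by auto
      show "card E' < card E"
        using j E' finE by (intro psubset_card_mono) auto
      show "simple_graph (\<Union>E') E'"
        using less.prems(1) WV EE finite_subset[OF WV] unfolding simple_graph_def by auto
      show "planar (\<Union>E') E'"
        by (rule planar_subgraph[OF less.prems(2) WV EE])
      show "interval_colouring (\<Union>E') E' c"
        using interval_colouring_restrict[OF less.prems(3) WV I] E' by simp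
      have "uv \<subseteq> \<Union>E'" using uvE \<open>i \<in> I\<close> E' by auto
      then show "2 \<le> card (\<Union>E')"
        using card_mono[OF finite_subset[OF WV finV]] card_uv(1) by metis
    qed
    define E1 where "E1 = {e \<in> E. c e \<in> {..i}}"
    define E2 where "E2 = {e \<in> E. c e \<in> {i..}}"
    have sub: "\<Union>E1 \<subseteq> V" "\<Union>E2 \<subseteq> V"
      using less.prems(1) unfolding E1_def E2_def simple_graph_def by auto
    have Max_Min: "Max (c ` E) \<in> c ` E" "Min (c ` E) \<in> c ` E"
      using finE i(1) by (auto intro!: Max_in Min_in simp del: Max_in Min_in)
    have "i \<le> Max (c ` E)" "Min (c ` E) \<le> i"
      using finE i(1) by simp_all
    then have strict: "i < Max (c ` E)" "Min (c ` E) < i"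
      using i(2,3) by simp_all
    have le1: "2 * card (c ` E1) + 4 \<le> 3 * card (\<Union>E1)"
    proof (rule side[OF E1_def, where j = "Max (c ` E)"])
      show "\<exists>a' b'. {a..b} \<inter> {..i} = {a'..b'}" for a b :: nat
        by (intro exI[of _ a] exI[of _ "min b i"]) auto
    qed (use Max_Min strict in auto)
    have le2: "2 * card (c ` E2) + 4 \<le> 3 * card (\<Union>E2)"
    proof (rule side[OF E2_def, where j = "Min (c ` E)"])
      show "\<exists>a' b'. {a..b} \<inter> {i..} = {a'..b'}" for a b :: nat
        by (intro exI[of _ "max a i"] exI[of _ b]) auto
    qed (use Max_Min strict in auto)
    have "\<Union>E1 \<inter> \<Union>E2 \<subseteq> uv"
    proof
      fix w assume "w \<in> \<Union>E1 \<inter> \<Union>E2"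
      then obtain e e' where e: "e \<in> E" "w \<in> e" "c e \<le> i" "e' \<in> E" "w \<in> e'" "i \<le> c e'"
        unfolding E1_def E2_def by auto
      have "w \<in> V" using sub(1) \<open>w \<in> \<Union>E1 \<inter> \<Union>E2\<close> by (meson IntD1 subsetD)
      then obtain a b where ab: "c ` incident_edges E w = {a..b}"
        using interval_colouringD[OF less.prems(3)] by blast
      have "c e \<in> {a..b}" "c e' \<in> {a..b}"
        using e unfolding ab[symmetric] incident_edges_def by auto
      then have "i \<in> c ` incident_edges E w" using e ab by auto
      then show "w \<in> uv" using uv unfolding incident_edges_def by auto
    qed
    then have "card (\<Union>E1 \<inter> \<Union>E2) \<le> 2"
      using card_mono[OF finite_subset[OF card_uv(2) finV]] card_uv(1) by metis
    moreover have "card (\<Union>E1) + card (\<Union>E2) = card (\<Union>E1 \<union> \<Union>E2) + card (\<Union>E1 \<inter> \<Union>E2)"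
      using sub finV by (intro card_Un_Int) (auto intro: finite_subset)
    moreover have "card (\<Union>E1 \<union> \<Union>E2) \<le> card V"
      using sub finV by (intro card_mono) auto
    moreover have "card (c ` E1) + card (c ` E2) = card (c ` E) + 1"
    proof -
      have "c ` E1 = c ` E \<inter> {..i}" "c ` E2 = c ` E \<inter> {i..}"
        unfolding E1_def E2_def by auto
      moreover have "{..i} \<union> {i..} = UNIV" "{..i} \<inter> {i..} = {i}" by auto
      ultimately have "c ` E1 \<union> c ` E2 = c ` E" "c ` E1 \<inter> c ` E2 = {i}"
        using i(1) by blast+
      then show ?thesis
        using card_Un_Int[of "c ` E1" "c ` E2"] finE unfolding E1_def E2_def by simp
    qed
    \<comment> \<open>Adding the two bounds gives 2(t + 1) + 8 \<le> 3(n + 2), that is 2t + 4 \<le>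
      3n.\<close>
    ultimately show ?thesis using le1 le2 by linarith
  qed
qed

theorem theorem3:
  fixes V :: "'a set" and E :: "'a set set"
  assumes "simple_graph V E"
    and "planar V E"
    and "card V \<ge> 2"
    and "interval_colourable V E"
  shows "real (t_max V E) \<le> 3 / 2 * real (card V) - 2"
proof -
  let ?T = "{card (c ` E) | c. interval_colouring V E c}"
  \<comment> \<open>Finiteness and nonemptiness ensure that \<open>Max\<close> is attained by an
    actual colouring.\<close>
  have "?T \<subseteq> {..card E}"
    by (auto intro: card_image_le simple_graph_finite_edges[OF assms(1)])
  then have "finite ?T" by (rule finite_subset) simp
  moreover have "?T \<noteq> {}" using assms(4) unfolding interval_colourable_def by auto
  ultimately have "t_max V E \<in> ?T" unfolding t_max_def by (rule Max_in)
  then obtain c where "t_max V E = card (c ` E)" "interval_colouring V E c" by auto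
  then have "2 * t_max V E + 4 \<le> 3 * card V"
    using colours_bound[OF assms(1,2) _ assms(3)] by simp
  then show ?thesis by linarith
qed
end
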